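(* For any vertex $v$ in a graph $G$ of diameter $2$, $\mathrm{str}(v)$ equals the number of unordered pairs of (distinct) non-adjacent vertices in $N(v)$.
   Context: Graphs are finite, undirected and simple. A geodesic is a shortest path between two vertices (a path and its reverse are the same geodesic); it passes through a vertex $v$ if $v$ is an internal vertex of it. The diameter of $G$ is the length (number of edges) of a longest geodesic in $G$. The stress $\mathrm{str}(v)$ of a vertex $v$ is the number of geodesics in $G$ passing through $v$. $N(v)$ is the set of vertices adjacent to $v$. *)

theory Defs
  imports "Graph_Theory.Graph_Theory"
begin

text \<open>
  A finite simple undirected graph is the locale \<^locale>\<open>graph\<close>: finite, loop-free, at most one
  arc from one vertex to another, and symmetric.  Since there are no parallel arcs, a path is
  given by its list of vertices (\<^const>\<open>vpath\<close>).

  Here \<^term>\<open>geodesic G p\<close> concerns the vertex list, i.e. a geodesic traversed in one of its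
  directions.  Connectedness is not assumed: only vertices joined by a path have a geodesic
  between them.
\<close>

definition geodesic :: "('a, 'b) pre_digraph \<Rightarrow> 'a vwalk \<Rightarrow> bool" where
  "geodesic G p \<longleftrightarrow> vpath p G \<and>
     (\<forall>q. vpath q G \<and> hd q = hd p \<and> last q = last p \<longrightarrow> vwalk_length p \<le> vwalk_length q)"

text \<open>Well-behaved only if \<^term>\<open>verts G\<close> is nonempty, as the null graph has no geodesics.\<close>

definition diameter :: "('a, 'b) pre_digraph \<Rightarrow> nat" where
  "diameter G = Max {vwalk_length p | p. geodesic G p}"

definition passes_through :: "'a vwalk \<Rightarrow> 'a \<Rightarrow> bool" where
  "passes_through p v \<longleftrightarrow> v \<in> set (butlast (tl p))"

text \<open>A path and its reverse are the same geodesic, hence the classes \<^term>\<open>{p, rev p}\<close>.\<close>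

definition stress :: "('a, 'b) pre_digraph \<Rightarrow> 'a \<Rightarrow> nat" where
  "stress G v = card {{p, rev p} | p. geodesic G p \<and> passes_through p v}"

definition neighbourhood :: "('a, 'b) pre_digraph \<Rightarrow> 'a \<Rightarrow> 'a set" where
  "neighbourhood G v = {u \<in> verts G. v \<rightarrow>\<^bsub>G\<^esub> u}"

end

theory Submission
  imports Defs
begin

text \<open>
  A path of length at most \<open>2\<close> has at most one internal vertex, so in a graph of diameter \<open>2\<close> every
  geodesic through \<open>v\<close> has the form \<open>x, v, y\<close>.  Its ends are neighbours of \<open>v\<close>; they are
  non-adjacent, for an edge between them would be a shorter path.  Conversely, if \<open>x\<close> and \<open>y\<close> are
  distinct and non-adjacent then no path between them has length less than \<open>2\<close>, so that \<open>x, v, y\<close>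
  is a geodesic for every common neighbour \<open>v\<close> (\<open>geodesic_two_edges_iff\<close>).  Since reversal of
  \<open>x, v, y\<close> swaps the two ends, an undirected geodesic through \<open>v\<close> corresponds to the unordered
  pair of its ends, and counting the former is counting the latter.
\<close>

text \<open>
  The maximum in \<^const>\<open>diameter\<close> bounds its elements only because there are finitely many lengths:
  a path does not repeat vertices, so that its length is bounded by the number of vertices.
\<close>

lemma (in fin_digraph) geodesic_length_le_diameter:
  assumes "geodesic G p"
  shows "vwalk_length p \<le> diameter G"
proof -
  have "vwalk_length q \<le> card (verts G)" if "geodesic G q" for q
  proof -
    have "distinct q" "set q \<subseteq> verts G"
      using that by (auto simp: geodesic_def)
    then have "length q \<le> card (verts G)"
      by (metis card_mono distinct_card finite_verts)
    then show ?thesis by simp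
  qed
  then have "finite {vwalk_length q | q. geodesic G q}"
    by (intro finite_subset[OF _ finite_atMost[of "card (verts G)"]]) auto
  then show ?thesis
    unfolding diameter_def using assms by (intro Max_ge) auto
qed

lemma (in graph) geodesic_two_edges_iff:
  "geodesic G [x, v, y] \<longleftrightarrow>
     x \<in> neighbourhood G v \<and> y \<in> neighbourhood G v \<and> x \<noteq> y \<and> \<not> x \<rightarrow>\<^bsub>G\<^esub> y"
proof
  assume geo: "geodesic G [x, v, y]"
  then have path: "x \<rightarrow>\<^bsub>G\<^esub> v" "v \<rightarrow>\<^bsub>G\<^esub> y" "x \<noteq> y" "{x, v, y} \<subseteq> verts G"
    by (auto simp: geodesic_def vpath_def vwalk_def)
  have "\<not> x \<rightarrow>\<^bsub>G\<^esub> y"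
  proof
    assume "x \<rightarrow>\<^bsub>G\<^esub> y"
    then have "vpath [x, y] G"
      using path by (auto simp: vpath_def vwalk_def)
    then have "vwalk_length [x, v, y] \<le> vwalk_length [x, y]"
      using geo by (auto simp: geodesic_def simp del: vwalk_length_simp)
    then show False by simp
  qed
  then show "x \<in> neighbourhood G v \<and> y \<in> neighbourhood G v \<and> x \<noteq> y \<and> \<not> x \<rightarrow>\<^bsub>G\<^esub> y"
    using path graph_symmetric[OF path(1)] by (auto simp: neighbourhood_def)
next
  assume ends: "x \<in> neighbourhood G v \<and> y \<in> neighbourhood G v \<and> x \<noteq> y \<and> \<not> x \<rightarrow>\<^bsub>G\<^esub> y"
  then have adj: "v \<rightarrow>\<^bsub>G\<^esub> x" "v \<rightarrow>\<^bsub>G\<^esub> y"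
    by (auto simp: neighbourhood_def)
  have "vpath [x, v, y] G"
    using ends adj graph_symmetric[OF adj(1)] adj_not_same[of v] adj_in_verts[OF adj(1)]
      adj_in_verts[OF adj(2)]
    by (auto simp: vpath_def vwalk_def)
  moreover have "vwalk_length [x, v, y] \<le> vwalk_length q" if q: "vpath q G" "hd q = x" "last q = y" for q
  proof (rule ccontr)
    assume "\<not> vwalk_length [x, v, y] \<le> vwalk_length q"
    moreover have "q \<noteq> []"
      using q by auto
    ultimately consider "q = [x]" | b where "q = [x, b]"
      using q(2) by (cases q rule: vwalk_arcs.cases) (auto simp: Suc_le_eq)
    then show False
      using q ends by cases (auto simp: vpath_def vwalk_def)
  qed
  ultimately show "geodesic G [x, v, y]"
    by (auto simp: geodesic_def simp del: vwalk_length_simp)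
qed

lemma short_path_through_iff:
  assumes "vwalk_length p \<le> 2"
  shows "passes_through p v \<longleftrightarrow> (\<exists>x y. p = [x, v, y])"
proof
  assume v: "passes_through p v"
  then obtain x q where "p = x # q" "v \<in> set (butlast q)"
    by (cases p) (auto simp: passes_through_def)
  moreover from this obtain z r where "q = z # r" "r \<noteq> []"
    by (cases q) (auto split: if_splits)
  moreover from this obtain y s where "r = y # s"
    by (cases r) auto
  ultimately show "\<exists>x y. p = [x, v, y]"
    using assms by auto
qed (auto simp: passes_through_def)

theorem corollary5p3:
  fixes G :: "('a, 'b) pre_digraph" and v :: 'a
  assumes "graph G"
    and "diameter G = 2"
    and "v \<in> verts G"
  shows "stress G v =
    card {{x, y} | x y. x \<in> neighbourhood G v \<and> y \<in> neighbourhood G v \<and>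
                        x \<noteq> y \<and> \<not> x \<rightarrow>\<^bsub>G\<^esub> y}"
    (is "_ = card ?pairs")
proof -
  interpret graph G by fact
  have through: "geodesic G p \<and> passes_through p v \<longleftrightarrow> (\<exists>x y. p = [x, v, y] \<and> geodesic G p)" for p
    using geodesic_length_le_diameter[of p] short_path_through_iff[of p v] assms(2) by auto
  \<comment> \<open>Using all orderings of the pair \<open>e\<close> makes the class of a path and its reverse a function of
    the unordered pair of its ends.\<close>
  define paths where "paths e = {[a, v, b] | a b. {a, b} = e}" for e
  have paths_pair: "paths {x, y} = {[x, v, y], rev [x, v, y]}" for x y
    by (auto simp: paths_def doubleton_eq_iff)
  have "{{p, rev p} | p. geodesic G p \<and> passes_through p v} =
      {paths {x, y} | x y. geodesic G [x, v, y]}"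
    unfolding through paths_pair by blast
  also have "\<dots> = paths ` ?pairs"
    unfolding geodesic_two_edges_iff by blast
  finally have "stress G v = card (paths ` ?pairs)"
    by (simp add: stress_def)
  moreover have "inj_on paths ?pairs"
  proof (rule inj_onI)
    fix e e' assume "e \<in> ?pairs" "paths e = paths e'"
    then obtain x y where "e = {x, y}" "[x, v, y] \<in> paths e'"
      using paths_pair by blast
    then show "e = e'"
      by (auto simp: paths_def)
  qed
  ultimately show ?thesis
    by (simp add: card_image)
qed

end
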